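(* Let $T:\mathbb{R}^N\to\mathbb{R}^M$ be linear, $g\in\mathbb{R}^M$, and $\gamma>0$. For any sequence $(r_n)$ of positive reals satisfying $r_n\to0$, the functionals $$\mathcal{J}_n(u)=\|Tu-g\|_{\ell_2}^2+\frac{\gamma}{r_n}\sum_{j=1}^N\min\{|u_j|,r_n\},\qquad u\in\mathbb{R}^N,$$ $\Gamma$-converge, in the metric of $\ell_2^N$, to the functional $$\mathcal{F}^0_\gamma(u)=\|Tu-g\|_{\ell_2}^2+\gamma\|u\|_{\ell_0},$$ where $\|u\|_{\ell_0}=\#\{j:u_j\ne0\}$.
   Context: $\Gamma$-convergence: for a metric space $(X,d)$ and $f,f_n:X\to[0,\infty]$, $(f_n)$ $\Gamma$-converges to $f$ if (i) for any sequence $(x_n)\subset X$ converging to $x$, $\liminf_nf_n(x_n)\ge f(x)$; and (ii) for any $x\in X$ there exists a sequence $(x_n)\subset X$ converging to $x$ such that $\limsup_nf_n(x_n)\le f(x)$. *)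

theory Defs
  imports "HOL-Analysis.Analysis"
begin

definition gamma_converges :: "(nat \<Rightarrow> 'a::metric_space \<Rightarrow> ennreal) \<Rightarrow> ('a \<Rightarrow> ennreal) \<Rightarrow> bool" where
  "gamma_converges F f \<longleftrightarrow>
     (\<forall>x X. X \<longlonglongrightarrow> x \<longrightarrow> f x \<le> liminf (\<lambda>n. F n (X n))) \<and>
     (\<forall>x. \<exists>X. X \<longlonglongrightarrow> x \<and> limsup (\<lambda>n. F n (X n)) \<le> f x)"

definition l0_norm :: "real ^ 'n::finite \<Rightarrow> nat" where
  "l0_norm u = card {j. u $ j \<noteq> 0}"

text \<open>The \<open>norm\<close> of \<open>real ^ 'm\<close> and the distance of \<open>real ^ 'n\<close> are the Euclidean ones.\<close>

definition J_functional ::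
  "(real ^ 'n::finite \<Rightarrow> real ^ 'm::finite) \<Rightarrow> real ^ 'm \<Rightarrow> real \<Rightarrow> real \<Rightarrow> real ^ 'n \<Rightarrow> real" where
  "J_functional T g \<gamma> r u =
     (norm (T u - g))\<^sup>2 + \<gamma> / r * (\<Sum>j\<in>UNIV. min \<bar>u $ j\<bar> r)"

definition F0_functional ::
  "(real ^ 'n::finite \<Rightarrow> real ^ 'm::finite) \<Rightarrow> real ^ 'm \<Rightarrow> real \<Rightarrow> real ^ 'n \<Rightarrow> real" where
  "F0_functional T g \<gamma> u = (norm (T u - g))\<^sup>2 + \<gamma> * real (l0_norm u)"

text \<open>By the next two facts, \<open>ennreal\<close> truncates no value of either functional.\<close>

lemma J_functional_nonneg: "\<gamma> > 0 \<Longrightarrow> r > 0 \<Longrightarrow> J_functional T g \<gamma> r u \<ge> 0"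
  unfolding J_functional_def
  by (intro add_nonneg_nonneg mult_nonneg_nonneg sum_nonneg divide_nonneg_nonneg) auto

lemma F0_functional_nonneg: "\<gamma> > 0 \<Longrightarrow> F0_functional T g \<gamma> u \<ge> 0"
  unfolding F0_functional_def by simp

end

(* The truncation min \<bar>t\<bar> r / r is at most 1, and vanishes at t = 0, so J_n \<le> F everywhere and constant
   sequences are recovery sequences. Conversely, if u_n \<longlonglongrightarrow> u, then each of the finitely many
   coordinates with u_j \<noteq> 0 eventually exceeds r_n in modulus and contributes a full \<gamma>, so that
   J_n(u_n) is eventually at least \<parallel>T u_n - g\<parallel>\<^sup>2 + \<gamma> \<parallel>u\<parallel>_0, which tends to F(u). *)
theory Submission
  imports Defs
begin

lemma sum_min_le_l0_norm:
  fixes u :: "real ^ 'n::finite"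
  assumes "r \<ge> 0"
  shows "(\<Sum>j\<in>UNIV. min \<bar>u $ j\<bar> r) \<le> r * real (l0_norm u)"
proof -
  \<comment> \<open>Where \<open>u $ j = 0\<close> the minimum is exactly 0, since
    \<open>r \<ge> 0\<close> keeps it from being negative.\<close>
  have "(\<Sum>j\<in>UNIV. min \<bar>u $ j\<bar> r) \<le> (\<Sum>j\<in>UNIV. if u $ j \<noteq> 0 then r else 0)"
    using assms by (intro sum_mono) auto
  also have "\<dots> = r * real (l0_norm u)"
    by (simp add: l0_norm_def sum.If_cases Collect_neg_eq)
  finally show ?thesis .
qed

text \<open>Here \<open>u\<close> supplies the support and \<open>v\<close> the values: later
  \<open>u\<close> is a limit and \<open>v\<close> a late term of a sequence tending to it. On the
  support of \<open>u\<close> the minimum equals \<open>r\<close>; off it the terms are only bounded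
  below by 0.\<close>

lemma l0_norm_le_sum_min:
  fixes u v :: "real ^ 'n::finite"
  assumes "r \<ge> 0" and "\<And>j. u $ j \<noteq> 0 \<Longrightarrow> r \<le> \<bar>v $ j\<bar>"
  shows "r * real (l0_norm u) \<le> (\<Sum>j\<in>UNIV. min \<bar>v $ j\<bar> r)"
proof -
  have "r * real (l0_norm u) = (\<Sum>j\<in>UNIV. if u $ j \<noteq> 0 then r else 0)"
    by (simp add: l0_norm_def sum.If_cases Collect_neg_eq)
  also have "\<dots> \<le> (\<Sum>j\<in>UNIV. min \<bar>v $ j\<bar> r)"
    using assms by (intro sum_mono) auto
  finally show ?thesis .
qed

lemma J_functional_le_F0_functional:
  assumes "\<gamma> \<ge> 0" and "r > 0"
  shows "J_functional T g \<gamma> r u \<le> F0_functional T g \<gamma> u"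
proof -
  have "\<gamma> / r * (\<Sum>j\<in>UNIV. min \<bar>u $ j\<bar> r) \<le> \<gamma> / r * (r * real (l0_norm u))"
    using assms by (intro mult_left_mono sum_min_le_l0_norm) auto
  with assms show ?thesis
    by (simp add: J_functional_def F0_functional_def)
qed

lemma J_functional_ge:
  assumes "\<gamma> \<ge> 0" and "r > 0" and "\<And>j. u $ j \<noteq> 0 \<Longrightarrow> r \<le> \<bar>v $ j\<bar>"
  shows "(norm (T v - g))\<^sup>2 + \<gamma> * real (l0_norm u) \<le> J_functional T g \<gamma> r v"
proof -
  have "\<gamma> / r * (r * real (l0_norm u)) \<le> \<gamma> / r * (\<Sum>j\<in>UNIV. min \<bar>v $ j\<bar> r)"
    using assms by (intro mult_left_mono l0_norm_le_sum_min) auto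
  with assms show ?thesis
    by (simp add: J_functional_def)
qed

text \<open>A nonzero coordinate of the limit keeps the sequence eventually away from 0 there, while
  \<open>r n\<close> shrinks to 0. The index from which this holds depends on \<open>j\<close>;
  finiteness of the index type makes it uniform.\<close>

lemma eventually_le_abs_nth:
  fixes X :: "nat \<Rightarrow> real ^ 'n::finite"
  assumes "X \<longlonglongrightarrow> x" and "r \<longlonglongrightarrow> 0"
  shows "\<forall>\<^sub>F n in sequentially. \<forall>j. x $ j \<noteq> 0 \<longrightarrow> r n \<le> \<bar>X n $ j\<bar>"
proof (intro eventually_all_finite)
  fix j
  show "\<forall>\<^sub>F n in sequentially. x $ j \<noteq> 0 \<longrightarrow> r n \<le> \<bar>X n $ j\<bar>"
  proof (cases "x $ j = 0")
    case False
    have "(\<lambda>n. \<bar>X n $ j\<bar> - r n) \<longlonglongrightarrow> \<bar>x $ j\<bar> - 0"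
      by (intro tendsto_intros assms)
    with False have "\<forall>\<^sub>F n in sequentially. 0 < \<bar>X n $ j\<bar> - r n"
      by (intro order_tendstoD(1)) auto
    then show ?thesis
      by eventually_elim auto
  qed auto
qed

theorem proposition4p4p1:
  fixes T :: "real ^ 'n::finite \<Rightarrow> real ^ 'm::finite"
    and g :: "real ^ 'm"
    and \<gamma> :: real
    and r :: "nat \<Rightarrow> real"
  assumes "linear T"
    and "\<gamma> > 0"
    and "\<And>n. r n > 0"
    and "r \<longlonglongrightarrow> 0"
  shows "gamma_converges (\<lambda>n u. ennreal (J_functional T g \<gamma> (r n) u))
           (\<lambda>u. ennreal (F0_functional T g \<gamma> u))"
  unfolding gamma_converges_def
proof (intro conjI allI impI)
  fix x and X :: "nat \<Rightarrow> real ^ 'n"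
  assume X: "X \<longlonglongrightarrow> x"
  \<comment> \<open>As \<open>l0_norm\<close> is not continuous, the count is frozen at the limit
    \<open>x\<close>. Only the fidelity term varies with \<open>n\<close>, so \<open>?G\<close>
    converges.\<close>
  let ?G = "\<lambda>n. (norm (T (X n) - g))\<^sup>2 + \<gamma> * real (l0_norm x)"
  have "(\<lambda>n. T (X n)) \<longlonglongrightarrow> T x"
    using X \<open>linear T\<close> by (simp add: bounded_linear.tendsto linear_conv_bounded_linear)
  then have "?G \<longlonglongrightarrow> F0_functional T g \<gamma> x"
    unfolding F0_functional_def by (intro tendsto_intros)
  then have "(\<lambda>n. ennreal (?G n)) \<longlonglongrightarrow> ennreal (F0_functional T g \<gamma> x)"
    by (rule tendsto_ennrealI)
  then have "ennreal (F0_functional T g \<gamma> x) = liminf (\<lambda>n. ennreal (?G n))"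
    by (simp add: lim_imp_Liminf)
  also have "\<dots> \<le> liminf (\<lambda>n. ennreal (J_functional T g \<gamma> (r n) (X n)))"
  proof (rule Liminf_mono)
    \<comment> \<open>This may fail for early \<open>n\<close>, where \<open>r n\<close> can exceed
      a nonzero coordinate; the liminf ignores those.\<close>
    show "\<forall>\<^sub>F n in sequentially. ennreal (?G n) \<le> ennreal (J_functional T g \<gamma> (r n) (X n))"
      using eventually_le_abs_nth[OF X \<open>r \<longlonglongrightarrow> 0\<close>]
      by eventually_elim (intro ennreal_leI J_functional_ge; use assms in \<open>auto simp: less_imp_le\<close>)
  qed
  finally show "ennreal (F0_functional T g \<gamma> x)
      \<le> liminf (\<lambda>n. ennreal (J_functional T g \<gamma> (r n) (X n)))" .
next
  fix x
  \<comment> \<open>The bound holds for each single \<open>n\<close> at the fixed point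
    \<open>x\<close>, hence passes to the limsup.\<close>
  have "limsup (\<lambda>n. ennreal (J_functional T g \<gamma> (r n) x)) \<le> ennreal (F0_functional T g \<gamma> x)"
    using assms by (intro Limsup_bounded always_eventually allI ennreal_leI
        J_functional_le_F0_functional) (auto simp: less_imp_le)
  then show "\<exists>X. X \<longlonglongrightarrow> x \<and>
      limsup (\<lambda>n. ennreal (J_functional T g \<gamma> (r n) (X n))) \<le> ennreal (F0_functional T g \<gamma> x)"
    by (intro exI[of _ "\<lambda>_. x"]) auto
qed

end
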